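(* Let $H$ be a connected bipartite graph with bipartition $(A,B)$, and let $H_1, H_2$ be two vertex-disjoint copies of $H$. If $u \in V(H_1)$ and $v \in V(H_2)$ are such that the vertices of $H$ corresponding to $u$ and $v$ both lie in $A$ or both lie in $B$, then \[ \mathrm{ex}(n, H_1^u \odot H_2^v) = \Theta\bigl(\mathrm{ex}(n,H)\bigr). \]
   Context: $\mathrm{ex}(n,F)$ is the maximum number of edges in an $n$-vertex graph containing no subgraph isomorphic to $F$. For graphs $H_1,H_2$ with disjoint vertex sets and vertices $u\in V(H_1)$, $v\in V(H_2)$, $H_1^u\odot H_2^v$ denotes the graph obtained from the disjoint union of $H_1$ and $H_2$ by identifying $u$ and $v$. $\Theta$ refers to $n\to\infty$, with implied constants depending on $H$ and the choice of $u,v$.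
   Formalization: The case where H is a single edge K_2 is excluded: there ex(n,H)=0, but gluing two copies gives the two-edge path, whose extremal number is floor(n/2), so the claim is false. *)

theory Defs
  imports Complex_Main "HOL-Library.Landau_Symbols"
begin

record 'a sgraph =
  verts :: "'a set"
  edges :: "'a set set"

definition simple_graph :: "'a sgraph \<Rightarrow> bool" where
  "simple_graph G \<longleftrightarrow> finite (verts G) \<and>
     (\<forall>e\<in>edges G. \<exists>x\<in>verts G. \<exists>y\<in>verts G. x \<noteq> y \<and> e = {x, y})"

definition connected_graph :: "'a sgraph \<Rightarrow> bool" where
  "connected_graph G \<longleftrightarrow> verts G \<noteq> {} \<and>
     (\<forall>x\<in>verts G. \<forall>y\<in>verts G. (x, y) \<in> {(a, b). {a, b} \<in> edges G}\<^sup>*)"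

definition bipartition :: "'a sgraph \<Rightarrow> 'a set \<Rightarrow> 'a set \<Rightarrow> bool" where
  "bipartition G A B \<longleftrightarrow> A \<union> B = verts G \<and> A \<inter> B = {} \<and>
     (\<forall>e\<in>edges G. \<exists>a\<in>A. \<exists>b\<in>B. e = {a, b})"

definition graph_iso :: "('a \<Rightarrow> 'b) \<Rightarrow> 'a sgraph \<Rightarrow> 'b sgraph \<Rightarrow> bool" where
  "graph_iso f G G' \<longleftrightarrow> bij_betw f (verts G) (verts G') \<and> edges G' = (`) f ` edges G"

definition subgraph :: "'a sgraph \<Rightarrow> 'a sgraph \<Rightarrow> bool" where
  "subgraph S G \<longleftrightarrow> simple_graph S \<and> verts S \<subseteq> verts G \<and> edges S \<subseteq> edges G"

definition contains_copy :: "'b sgraph \<Rightarrow> 'a sgraph \<Rightarrow> bool" where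
  "contains_copy G F \<longleftrightarrow> (\<exists>S f. subgraph S G \<and> graph_iso f F S)"

text \<open>
  Every finite graph is isomorphic to one whose vertices are natural numbers, so it suffices to
  let \<open>G\<close> range over these. The set is finite, so its supremum is its maximum, except that
  it is empty when every graph on \<open>n\<close> vertices contains \<open>F\<close> (such as for \<open>F\<close> a single vertex
  and \<open>n \<ge> 1\<close>); then the value is \<open>0\<close>.
\<close>
definition ex_num :: "nat \<Rightarrow> 'a sgraph \<Rightarrow> nat" where
  "ex_num n F = Sup {card (edges G) | G :: nat sgraph.
     simple_graph G \<and> card (verts G) = n \<and> \<not> contains_copy G F}"

text \<open>
  Identification of \<open>u\<close> and \<open>v\<close> in the union of \<open>G\<close> and \<open>G'\<close>, the merged vertex being named
  \<open>u\<close>. Only meaningful for \<open>u \<in> verts G\<close>, \<open>v \<in> verts G'\<close> and disjoint vertex sets.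
\<close>
definition glue :: "'a sgraph \<Rightarrow> 'a \<Rightarrow> 'a sgraph \<Rightarrow> 'a \<Rightarrow> 'a sgraph" where
  "glue G u G' v = (let q = (\<lambda>x. if x = v then u else x) in
     \<lparr>verts = q ` (verts G \<union> verts G'), edges = (`) q ` (edges G \<union> edges G')\<rparr>)"

end

theory Submission
  imports Defs
begin

text \<open>
  The upper bound rests on a one-sided statement. Let \<open>G\<close> be bipartite between \<open>X\<close> and \<open>Y\<close>, and suppose
  that no two copies of \<open>H\<close> with \<open>A\<close> placed in \<open>X\<close> meet exactly in a vertex that is the image of \<open>a\<close> in
  one and of \<open>b\<close> in the other. Split \<open>Y\<close> into \<open>T\<close> and \<open>Y - T\<close> so that most neighbourhoods are divided
  evenly, and split \<open>X\<close> at random into \<open>S\<close> and \<open>X - S\<close>. A vertex \<open>x\<close> of \<open>X\<close> cannot be both the image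
  of \<open>a\<close> in a copy inside \<open>S \<union> {x}\<close>, \<open>T\<close> and the image of \<open>b\<close> in a copy inside \<open>(X - S) \<union> {x}\<close>,
  \<open>Y - T\<close>. Which of the two fails does not depend on the side that \<open>x\<close> itself falls on, so with
  probability at least 1/2 the vertex \<open>x\<close> falls on a side where it is harmless. Keeping only
  these vertices leaves a positive fraction of the edges and no copy of \<open>H\<close> with \<open>A\<close> in \<open>X\<close>.
  Starting from a maximum cut and applying this in both directions gives an \<open>H\<close>-free graph,
  because \<open>H\<close> is connected. The additive loss is linear in \<open>n\<close>, and so is absorbed by \<open>ex(n, H)\<close> when
  \<open>H\<close> has two edges.
\<close>

section \<open>Averaging over subsets\<close>

text \<open>Flipping a single vertex is an involution of \<open>Pow V\<close>. Pairing subsets in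
  this way replaces conditioning a random subset on its part away from \<open>x\<close>.\<close>

definition toggle :: "'a \<Rightarrow> 'a set \<Rightarrow> 'a set" where
  "toggle x S = (if x \<in> S then S - {x} else insert x S)"

lemma toggle_toggle [simp]: "toggle x (toggle x S) = S"
  by (auto simp: toggle_def)

lemma mem_toggle_same [simp]: "x \<in> toggle x S \<longleftrightarrow> x \<notin> S"
  by (auto simp: toggle_def)

text \<open>An event phrased through \<open>insert x S\<close> and \<open>insert x (V - S)\<close>
  does not see the side of \<open>x\<close>. This is the independence behind the random split of
  \<open>X\<close>.\<close>

lemma insert_toggle [simp]: "insert x (toggle x S) = insert x S"
  by (auto simp: toggle_def)

lemma insert_Diff_toggle [simp]: "insert x (V - toggle x S) = insert x (V - S)"
  by (auto simp: toggle_def)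

lemma bij_betw_toggle: "x \<in> V \<Longrightarrow> bij_betw (toggle x) (Pow V) (Pow V)"
  by (rule bij_betw_byWitness[where f' = "toggle x"]) (auto simp: toggle_def split: if_splits)

text \<open>Sum over all subsets and pair each \<open>S\<close> with \<open>toggle (t i) S\<close>:
  every \<open>i\<close> contributes at least \<open>m i / 2\<close> on average, and some
  \<open>S\<close> attains at least the average of the total.\<close>

lemma averaging_toggle:
  fixes F :: "'a set \<Rightarrow> 'i \<Rightarrow> real" and m :: "'i \<Rightarrow> real"
  assumes "finite V" and t: "\<And>i. i \<in> I \<Longrightarrow> t i \<in> V"
    and F: "\<And>S i. S \<subseteq> V \<Longrightarrow> i \<in> I \<Longrightarrow> m i \<le> F S i + F (toggle (t i) S) i"
  shows "\<exists>S\<subseteq>V. sum m I \<le> 2 * sum (F S) I"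
proof (rule ccontr)
  assume neg: "\<not> ?thesis"
  have "(\<Sum>S\<in>Pow V. sum m I) \<le> (\<Sum>S\<in>Pow V. 2 * sum (F S) I)"
  proof -
    have eq: "(\<Sum>S\<in>Pow V. F (toggle (t i) S) i) = (\<Sum>S\<in>Pow V. F S i)" if "i \<in> I" for i
      using sum.reindex_bij_betw[OF bij_betw_toggle[OF t[OF that]], of "\<lambda>S. F S i"] .
    have "(\<Sum>S\<in>Pow V. sum m I) = (\<Sum>i\<in>I. \<Sum>S\<in>Pow V. m i)"
      by (rule sum.swap)
    also have "\<dots> \<le> (\<Sum>i\<in>I. \<Sum>S\<in>Pow V. F S i + F (toggle (t i) S) i)"
      using F by (intro sum_mono) auto
    also have "\<dots> = (\<Sum>i\<in>I. 2 * (\<Sum>S\<in>Pow V. F S i))"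
      by (intro sum.cong refl) (simp add: sum.distrib eq)
    also have "\<dots> = (\<Sum>S\<in>Pow V. 2 * sum (F S) I)"
      by (simp add: sum_distrib_left sum.swap[of _ I])
    finally show ?thesis .
  qed
  moreover have "(\<Sum>S\<in>Pow V. sum m I) > (\<Sum>S\<in>Pow V. 2 * sum (F S) I)"
    using neg \<open>finite V\<close> by (intro sum_strict_mono) (auto simp: not_le)
  ultimately show False by simp
qed

text \<open>Flipping one chosen endpoint of an edge changes whether the edge is cut, so a random cut
  contains half of the edges on average. Ordered pairs are counted because the next steps work with
  a relation from one side to the other.\<close>

lemma max_cut:
  assumes "finite V" and E: "\<And>e. e \<in> E \<Longrightarrow> \<exists>x\<in>V. \<exists>y\<in>V. x \<noteq> y \<and> e = {x, y}"
  shows "\<exists>S\<subseteq>V. card E \<le> 2 * card {(x, y). {x, y} \<in> E \<and> x \<in> S \<and> y \<in> V - S}"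
proof -
  define sep where "sep S e \<longleftrightarrow> e \<inter> S \<noteq> {} \<and> e - S \<noteq> {}" for S e :: "'a set"
  obtain t where t: "t e \<in> V \<and> (\<exists>y. y \<noteq> t e \<and> e = {t e, y})" if "e \<in> E" for e
    using E by metis
  have "finite E"
    by (rule finite_subset[of _ "Pow V"]) (use E \<open>finite V\<close> in auto)
  have *: "1 \<le> of_bool (sep S e) + (of_bool (sep (toggle (t e) S) e) :: real)"
    if e: "e \<in> E" for S e
  proof -
    obtain y where "y \<noteq> t e" "e = {t e, y}" using t[OF e] by blast
    then show ?thesis by (auto simp: sep_def toggle_def)
  qed
  obtain S where S: "S \<subseteq> V" "(\<Sum>e\<in>E. 1) \<le> 2 * (\<Sum>e\<in>E. of_bool (sep S e) :: real)"
    using averaging_toggle[of V E t "\<lambda>_. 1" "\<lambda>S e. of_bool (sep S e)"] \<open>finite V\<close> t * by blast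
  let ?R = "{(x, y). {x, y} \<in> E \<and> x \<in> S \<and> y \<in> V - S}"
  have "finite ?R"
    by (rule finite_subset[of _ "V \<times> V"]) (use \<open>finite V\<close> S in auto)
  have "{e \<in> E. sep S e} \<subseteq> (\<lambda>(x, y). {x, y}) ` ?R"
  proof
    fix e assume e: "e \<in> {e \<in> E. sep S e}"
    then obtain x y where "x \<in> V" "y \<in> V" "x \<noteq> y" "e = {x, y}" using E by blast
    then have "(x, y) \<in> ?R \<or> (y, x) \<in> ?R"
      using e by (auto simp: sep_def insert_commute)
    then show "e \<in> (\<lambda>(x, y). {x, y}) ` ?R"
      using \<open>e = {x, y}\<close> by (metis (no_types, lifting) case_prod_conv image_eqI insert_commute)
  qed
  then have "card {e \<in> E. sep S e} \<le> card ?R"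
    using \<open>finite ?R\<close> by (rule surj_card_le[rotated])
  moreover have "card E \<le> 2 * card {e \<in> E. sep S e}"
  proof -
    have "(\<Sum>e\<in>E. of_bool (sep S e) :: real) = real (card {e \<in> E. sep S e})"
      using \<open>finite E\<close> by (simp add: of_bool_def sum.If_cases Int_def)
    then show ?thesis using S(2) by simp
  qed
  ultimately show ?thesis using S(1) by (intro exI[of _ S]) simp
qed

text \<open>
  A neighbourhood divided into \<open>p\<close> and \<open>q\<close> vertices contributes \<open>2pq\<close> separated ordered pairs, and
  \<open>min p q \<ge> pq / (p + q)\<close>; hence the weight \<open>1 / d x\<close> on each pair.
\<close>

lemma balanced_split:
  fixes R :: "('c \<times> 'c) set"
  assumes "finite X" "finite Y" and R: "R \<subseteq> X \<times> Y"
  shows "\<exists>T\<subseteq>Y. real (card R) - real (card X)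
    \<le> 4 * (\<Sum>x\<in>X. real (min (card (R `` {x} \<inter> T)) (card (R `` {x} - T))))"
proof -
  define d where "d x = card (R `` {x})" for x
  \<comment> \<open>Each index is a vertex with an ordered pair of distinct neighbours; flipping
    \<open>y\<close> alone changes whether \<open>T\<close> separates the pair.\<close>
  define I where "I = (SIGMA x:X. SIGMA y:R `` {x}. R `` {x} - {y})"
  define F where "F T i = (case i of (x, y, z) \<Rightarrow> of_bool ((y \<in> T) \<noteq> (z \<in> T)) / real (d x))"
    for T :: "'c set" and i
  define m where "m i = (case i of (x, y, z) \<Rightarrow> 1 / real (d x))" for i :: "'c \<times> 'c \<times> 'c"
  have fin: "finite (R `` {x})" for x
    by (rule finite_subset[of _ Y]) (use assms in auto)
  have sumI: "sum f I = (\<Sum>x\<in>X. \<Sum>(y, z)\<in>(SIGMA y:R `` {x}. R `` {x} - {y}). f (x, y, z))"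
    for f :: "'c \<times> 'c \<times> 'c \<Rightarrow> real"
  proof -
    have "sum f I = (\<Sum>(x, i)\<in>I. f (x, i))" by simp
    also have "\<dots> = (\<Sum>x\<in>X. \<Sum>i\<in>(SIGMA y:R `` {x}. R `` {x} - {y}). f (x, i))"
      unfolding I_def using fin \<open>finite X\<close> by (intro sum.Sigma[symmetric]) auto
    finally show ?thesis by (simp only: split_def prod.collapse)
  qed
  have "\<exists>T\<subseteq>Y. sum m I \<le> 2 * sum (F T) I"
    by (rule averaging_toggle[where t = "\<lambda>(x, y, z). y"])
      (use \<open>finite Y\<close> R in \<open>auto simp: I_def m_def F_def toggle_def\<close>)
  then obtain T where T: "T \<subseteq> Y" "sum m I \<le> 2 * sum (F T) I" by blast
  have "real (card R) - real (card X) = (\<Sum>x\<in>X. real (d x) - 1)"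
  proof -
    have "R = (SIGMA x:X. R `` {x})" using R by auto
    then have "card R = (\<Sum>x\<in>X. d x)"
      unfolding d_def using card_SigmaI[OF \<open>finite X\<close>, of "\<lambda>x. R `` {x}"] fin by simp
    then show ?thesis by (simp add: sum_subtractf)
  qed
  also have "\<dots> \<le> sum m I"
    unfolding sumI
  proof (rule sum_mono)
    fix x assume "x \<in> X"
    have "card (SIGMA y:R `` {x}. R `` {x} - {y}) = d x * (d x - 1)"
      using fin[of x] by (simp add: d_def)
    then have "(\<Sum>(y, z)\<in>(SIGMA y:R `` {x}. R `` {x} - {y}). m (x, y, z))
        = real (d x * (d x - 1)) / real (d x)"
      by (simp add: m_def split_def)
    \<comment> \<open>For \<open>d x = 0\<close> the quotient is 0 by convention, still above -1;
      isolated vertices are thus covered by the loss \<open>card X\<close>.\<close>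
    also have "\<dots> \<ge> real (d x) - 1"
      by (cases "d x") (auto simp: divide_simps algebra_simps)
    finally show "real (d x) - 1
        \<le> (\<Sum>(y, z)\<in>(SIGMA y:R `` {x}. R `` {x} - {y}). m (x, y, z))" .
  qed
  also have "\<dots> \<le> 2 * sum (F T) I" by (rule T)
  \<comment> \<open>The outer factor 2 is the averaging loss, the inner one comes from counting
    ordered pairs.\<close>
  also have "\<dots> \<le> 2 * (\<Sum>x\<in>X. 2 * real (min (card (R `` {x} \<inter> T)) (card (R `` {x} - T))))"
    unfolding sumI
  proof (intro mult_left_mono sum_mono)
    fix x assume "x \<in> X"
    let ?N = "R `` {x}" and ?P = "SIGMA y:R `` {x}. R `` {x} - {y}"
    define p q where "p = card (?N \<inter> T)" and "q = card (?N - T)"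
    have d: "d x = p + q"
      unfolding d_def p_def q_def using card_Int_Diff[OF fin] .
    have "{(y, z) \<in> ?P. (y \<in> T) \<noteq> (z \<in> T)} = (?N \<inter> T) \<times> (?N - T) \<union> (?N - T) \<times> (?N \<inter> T)"
      by auto
    moreover have "card \<dots> = 2 * p * q"
      using fin[of x] by (subst card_Un_disjoint) (auto simp: p_def q_def card_cartesian_product)
    ultimately have c: "card {(y, z) \<in> ?P. (y \<in> T) \<noteq> (z \<in> T)} = 2 * p * q" by simp
    have "finite ?P" using fin by auto
    have "(\<Sum>(y, z)\<in>?P. F T (x, y, z))
        = (\<Sum>i\<in>?P. of_bool ((fst i \<in> T) \<noteq> (snd i \<in> T))) / real (d x)"
      by (simp add: F_def split_def sum_divide_distrib)
    also have "(\<Sum>i\<in>?P. of_bool ((fst i \<in> T) \<noteq> (snd i \<in> T)))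
        = real (card {i \<in> ?P. (fst i \<in> T) \<noteq> (snd i \<in> T)})"
      using \<open>finite ?P\<close> by (simp only: of_bool_def sum.If_cases) (simp add: Int_def)
    also have "{i \<in> ?P. (fst i \<in> T) \<noteq> (snd i \<in> T)} = {(y, z) \<in> ?P. (y \<in> T) \<noteq> (z \<in> T)}"
      by auto
    also have "real (card \<dots>) / real (d x) = 2 * (real p * real q) / (real p + real q)"
      by (simp only: c d) simp
    also have "\<dots> \<le> 2 * real (min p q)"
    proof -
      have "real p * real q = real (min p q) * real (max p q)"
        by (auto simp: min_def max_def)
      also have "\<dots> \<le> real (min p q) * (real p + real q)"
        by (intro mult_left_mono) auto
      finally show ?thesis
        by (cases "p + q = 0") (auto simp: divide_simps)
    qed
    finally show "(\<Sum>(y, z)\<in>?P. F T (x, y, z)) \<le> 2 * real (min p q)" .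
  qed simp
  finally show ?thesis
    using T(1) by (intro exI[of _ T]) (simp add: sum_distrib_left)
qed

section \<open>One-sided embeddings\<close>

text \<open>A relation instead of an edge set keeps the orientation, with \<open>A\<close> on the
  left; the converse relation describes copies with the sides exchanged.\<close>

definition bip_emb :: "'a sgraph \<Rightarrow> 'a set \<Rightarrow> 'a set \<Rightarrow> ('c \<times> 'c) set \<Rightarrow> ('a \<Rightarrow> 'c) \<Rightarrow> bool" where
  "bip_emb H A B R f \<longleftrightarrow> inj_on f (A \<union> B) \<and>
     (\<forall>p\<in>A. \<forall>q\<in>B. {p, q} \<in> edges H \<longrightarrow> (f p, f q) \<in> R)"

lemma bip_emb_mono: "bip_emb H A B R f \<Longrightarrow> R \<subseteq> R' \<Longrightarrow> bip_emb H A B R' f"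
  unfolding bip_emb_def by blast

text \<open>The factor 16 is 4 from the balanced split, 2 from averaging over \<open>S\<close>, and
  2 for keeping the larger of \<open>R1\<close> and \<open>R2\<close>.\<close>

lemma one_sided_free_subgraph:
  fixes H :: "'a sgraph" and R :: "('c \<times> 'c) set"
  assumes "finite X" "finite Y" "X \<inter> Y = {}" and R: "R \<subseteq> X \<times> Y"
    and isoA: "\<And>p. p \<in> A \<Longrightarrow> \<exists>q\<in>B. {p, q} \<in> edges H"
    and isoB: "\<And>q. q \<in> B \<Longrightarrow> \<exists>p\<in>A. {p, q} \<in> edges H"
    and "a \<in> A" "b \<in> A"
    and no_pair: "\<And>f g. bip_emb H A B R f \<Longrightarrow> bip_emb H A B R g \<Longrightarrow> f a = g b \<Longrightarrow>
      f ` (A \<union> B) \<inter> g ` (A \<union> B) \<subseteq> {f a} \<Longrightarrow> False"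
  shows "\<exists>R'\<subseteq>R. (\<forall>f. \<not> bip_emb H A B R' f) \<and> card R \<le> 16 * card R' + card X"
proof -
  \<comment> \<open>Every vertex of \<open>H\<close> lies on an edge, so its image is an endpoint of
    a pair in the restricted relation.\<close>
  have img: "f ` A \<subseteq> S \<and> f ` B \<subseteq> T" if "bip_emb H A B (R \<inter> S \<times> T) f" for f S T
    using that isoA isoB unfolding bip_emb_def by blast
  obtain T where T: "T \<subseteq> Y" "real (card R) - real (card X)
    \<le> 4 * (\<Sum>x\<in>X. real (min (card (R `` {x} \<inter> T)) (card (R `` {x} - T))))"
    using balanced_split[OF assms(1,2,4)] by blast
  define d1 where "d1 x = card (R `` {x} \<inter> T)" for x
  define d2 where "d2 x = card (R `` {x} - T)" for x
  define M where "M = (\<Sum>x\<in>X. real (min (d1 x) (d2 x)))"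
  define P where "P S x \<longleftrightarrow> \<not> (\<exists>f. bip_emb H A B (R \<inter> insert x S \<times> T) f \<and> f a = x)" for S x
  define Q where "Q S x \<longleftrightarrow> \<not> (\<exists>g. bip_emb H A B (R \<inter> insert x (X - S) \<times> (Y - T)) g \<and> g b = x)"
    for S x
  define F where "F S x = (if x \<in> S \<and> P S x then real (d1 x) else 0) +
    (if x \<notin> S \<and> Q S x then real (d2 x) else 0)" for S x
  \<comment> \<open>The two copies live on complementary parts and can share only \<open>x\<close>,
    which is what \<open>no_pair\<close> forbids.\<close>
  have PQ: "P S x \<or> Q S x" if "S \<subseteq> X" "x \<in> X" for S x
  proof (rule ccontr)
    assume "\<not> (P S x \<or> Q S x)"
    then obtain f g where f: "bip_emb H A B (R \<inter> insert x S \<times> T) f" "f a = x"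
      and g: "bip_emb H A B (R \<inter> insert x (X - S) \<times> (Y - T)) g" "g b = x"
      unfolding P_def Q_def by blast
    have "f ` (A \<union> B) \<inter> g ` (A \<union> B) \<subseteq> {f a}"
    proof -
      have "f ` (A \<union> B) \<inter> g ` (A \<union> B) \<subseteq> (insert x S \<union> T) \<inter> (insert x (X - S) \<union> (Y - T))"
        using img[OF f(1)] img[OF g(1)] by blast
      also have "\<dots> \<subseteq> {x}" using that T(1) \<open>X \<inter> Y = {}\<close> by blast
      finally show ?thesis using f by simp
    qed
    then show False
      using no_pair[of f g] f g bip_emb_mono[of H A B _ _ R] by (metis inf_le1)
  qed
  have [simp]: "P (toggle x S) x = P S x" "Q (toggle x S) x = Q S x" for S x
    by (simp_all add: P_def Q_def)
  have "\<exists>S\<subseteq>X. (\<Sum>x\<in>X. real (min (d1 x) (d2 x))) \<le> 2 * sum (F S) X"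
  proof (rule averaging_toggle[where t = "\<lambda>x. x"])
    \<comment> \<open>If \<open>P S x\<close> holds, whichever of \<open>S\<close> and
      \<open>toggle x S\<close> contains \<open>x\<close> contributes \<open>d1 x\<close>; otherwise
      \<open>Q S x\<close> holds and the other one contributes \<open>d2 x\<close>.\<close>
    fix S x assume "S \<subseteq> X" "x \<in> X"
    then show "real (min (d1 x) (d2 x)) \<le> F S x + F (toggle x S) x"
      using PQ[of S x] by (auto simp: F_def)
  qed (use \<open>finite X\<close> in auto)
  then obtain S where S: "S \<subseteq> X" "(\<Sum>x\<in>X. real (min (d1 x) (d2 x))) \<le> 2 * sum (F S) X"
    by blast
  define R1 where "R1 = R \<inter> {x \<in> S. P S x} \<times> T"
  define R2 where "R2 = R \<inter> {x \<in> X - S. Q S x} \<times> (Y - T)"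
  have fin: "finite (R `` {x})" for x
    by (rule finite_subset[of _ Y]) (use assms in auto)
  have "R1 = (SIGMA x:{x \<in> X. x \<in> S \<and> P S x}. R `` {x} \<inter> T)"
    using S R by (auto simp: R1_def)
  then have c1: "card R1 = (\<Sum>x\<in>{x \<in> X. x \<in> S \<and> P S x}. d1 x)"
    using \<open>finite X\<close> fin by (simp add: d1_def)
  have "R2 = (SIGMA x:{x \<in> X. x \<notin> S \<and> Q S x}. R `` {x} - T)"
    using S R by (auto simp: R2_def)
  then have c2: "card R2 = (\<Sum>x\<in>{x \<in> X. x \<notin> S \<and> Q S x}. d2 x)"
    using \<open>finite X\<close> fin by (simp add: d2_def)
  have "sum (F S) X = real (card R1) + real (card R2)"
    using \<open>finite X\<close> by (simp add: F_def sum.distrib c1 c2 flip: sum.inter_filter)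
  then have "real (card R) - real (card X) \<le> 8 * (real (card R1) + real (card R2))"
    using T(2)[folded d1_def d2_def, folded M_def] S(2)[folded M_def] by argo
  then have "real (card R) \<le> real (8 * (card R1 + card R2) + card X)" by simp
  then have "card R \<le> 8 * (card R1 + card R2) + card X" by (simp only: of_nat_le_iff)
  then have bound: "card R \<le> 16 * card R1 + card X \<or> card R \<le> 16 * card R2 + card X"
    by presburger
  \<comment> \<open>The image of \<open>a\<close> under a copy in \<open>R1\<close> would satisfy
    \<open>P S\<close>, which denies such a copy; likewise \<open>b\<close>, \<open>R2\<close> and
    \<open>Q S\<close>.\<close>
  have "\<not> bip_emb H A B R1 f" for f
  proof
    assume f: "bip_emb H A B R1 f"
    then have "f a \<in> {x \<in> S. P S x}" using img \<open>a \<in> A\<close> unfolding R1_def by blast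
    moreover have "bip_emb H A B (R \<inter> insert (f a) S \<times> T) f"
      by (rule bip_emb_mono[OF f]) (auto simp: R1_def)
    ultimately show False unfolding P_def by blast
  qed
  moreover have "\<not> bip_emb H A B R2 f" for f
  proof
    assume f: "bip_emb H A B R2 f"
    then have "f b \<in> {x \<in> X - S. Q S x}" using img \<open>b \<in> A\<close> unfolding R2_def by blast
    moreover have "bip_emb H A B (R \<inter> insert (f b) (X - S) \<times> (Y - T)) f"
      by (rule bip_emb_mono[OF f]) (auto simp: R2_def)
    ultimately show False unfolding Q_def by blast
  qed
  moreover have "R1 \<subseteq> R" "R2 \<subseteq> R" by (auto simp: R1_def R2_def)
  ultimately show ?thesis using bound by blast
qed

section \<open>Copies and extremal numbers\<close>

lemma simple_graph_finite: "simple_graph G \<Longrightarrow> finite (verts G)"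
  by (simp add: simple_graph_def)

lemma simple_graph_edgeE:
  assumes "simple_graph G" "e \<in> edges G"
  obtains x y where "x \<noteq> y" "e = {x, y}" "x \<in> verts G" "y \<in> verts G"
proof -
  have "\<exists>x\<in>verts G. \<exists>y\<in>verts G. x \<noteq> y \<and> e = {x, y}"
    using assms by (simp add: simple_graph_def)
  then show thesis using that by (elim bexE conjE)
qed

lemma simple_graph_edge_subset: "simple_graph G \<Longrightarrow> e \<in> edges G \<Longrightarrow> e \<subseteq> verts G"
  by (erule (1) simple_graph_edgeE) simp

lemma graph_isoD:
  assumes "graph_iso f G G'"
  shows "inj_on f (verts G)" "f ` verts G = verts G'" "edges G' = (`) f ` edges G"
  using assms by (simp_all add: graph_iso_def bij_betw_def)

lemma contains_copyD:
  assumes "contains_copy G F"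
  shows "\<exists>f. inj_on f (verts F) \<and> f ` verts F \<subseteq> verts G \<and> (\<forall>e\<in>edges F. f ` e \<in> edges G)"
proof -
  obtain S f where Sf: "subgraph S G" "graph_iso f F S"
    using assms unfolding contains_copy_def by blast
  have S: "verts S \<subseteq> verts G" "edges S \<subseteq> edges G"
    using Sf(1) by (simp_all add: subgraph_def)
  have f: "inj_on f (verts F)" "f ` verts F = verts S" "edges S = (`) f ` edges F"
    using graph_isoD[OF Sf(2)] .
  have "f ` e \<in> edges G" if "e \<in> edges F" for e
    using S(2) imageI[OF that, of "(`) f"] unfolding f(3) by (rule subsetD)
  then show ?thesis using S(1) f(1,2) by (intro exI[of _ f]) simp
qed

lemma contains_copyI:
  assumes "simple_graph G" "finite (verts F)" "\<And>e. e \<in> edges F \<Longrightarrow> e \<subseteq> verts F"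
    and "inj_on f (verts F)" "f ` verts F \<subseteq> verts G" "\<And>e. e \<in> edges F \<Longrightarrow> f ` e \<in> edges G"
  shows "contains_copy G F"
proof -
  let ?S = "\<lparr>verts = f ` verts F, edges = (`) f ` edges F\<rparr>"
  have "\<exists>x\<in>f ` verts F. \<exists>y\<in>f ` verts F. x \<noteq> y \<and> f ` e = {x, y}" if e: "e \<in> edges F" for e
  proof -
    obtain x y where xy: "x \<noteq> y" "f ` e = {x, y}" "x \<in> verts G" "y \<in> verts G"
      using simple_graph_edgeE[OF assms(1) assms(6)[OF e]] .
    have "f ` e \<subseteq> f ` verts F" using assms(3)[OF e] by (rule image_mono)
    then have "x \<in> f ` verts F" "y \<in> f ` verts F" by (simp_all add: xy(2))
    then show ?thesis using xy by (intro bexI[of _ x] bexI[of _ y] conjI) simp_all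
  qed
  then have "simple_graph ?S"
    using assms(2) by (simp add: simple_graph_def)
  moreover have "(`) f ` edges F \<subseteq> edges G" using assms(6) by blast
  ultimately have "subgraph ?S G" using assms(5) by (simp add: subgraph_def)
  moreover have "graph_iso f F ?S" using assms(4) by (simp add: graph_iso_def bij_betw_def)
  ultimately show ?thesis unfolding contains_copy_def by blast
qed

section \<open>Bounds on extremal numbers\<close>

lemma finite_edge_counts:
  "finite {card (edges G) | G :: nat sgraph. simple_graph G \<and> card (verts G) = n \<and> \<not> contains_copy G F}"
proof (rule finite_subset)
  show "{card (edges G) | G :: nat sgraph. simple_graph G \<and> card (verts G) = n \<and> \<not> contains_copy G F}
    \<subseteq> {..2 ^ n}"
  proof clarify
    fix G :: "nat sgraph" assume G: "simple_graph G" "n = card (verts G)"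
    have "edges G \<subseteq> Pow (verts G)"
      using simple_graph_edge_subset[OF G(1)] by (rule subsetI[OF PowI])
    moreover have "finite (verts G)" using G(1) by (rule simple_graph_finite)
    ultimately show "card (edges G) \<le> 2 ^ card (verts G)"
      using card_mono[of "Pow (verts G)" "edges G"] by (simp add: card_Pow)
  qed
qed simp

lemma card_edges_le_ex_num:
  fixes G :: "nat sgraph"
  assumes "simple_graph G" "card (verts G) = n" "\<not> contains_copy G F"
  shows "card (edges G) \<le> ex_num n F"
  unfolding ex_num_def
  by (rule cSup_upper[OF _ bdd_above_finite[OF finite_edge_counts]]) (use assms in blast)

lemma ex_num_le:
  assumes "\<And>G :: nat sgraph. simple_graph G \<Longrightarrow> card (verts G) = n \<Longrightarrow> \<not> contains_copy G F \<Longrightarrow>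
    card (edges G) \<le> k"
  shows "ex_num n F \<le> k"
proof -
  let ?M = "{card (edges G) | G :: nat sgraph. simple_graph G \<and> card (verts G) = n \<and> \<not> contains_copy G F}"
  show ?thesis
  proof (cases "?M = {}")
    case True
    \<comment> \<open>Without any competing graph the supremum takes its default value 0.\<close>
    then show ?thesis unfolding ex_num_def by (metis Sup_nat_empty zero_le)
  next
    case False
    then show ?thesis unfolding ex_num_def by (rule cSup_least) (use assms in blast)+
  qed
qed

section \<open>Connected and bipartite graphs\<close>

lemma connected_graph_induct:
  assumes "connected_graph H" "x \<in> verts H" "y \<in> verts H" "P x"
    and "\<And>z w. {z, w} \<in> edges H \<Longrightarrow> P z \<Longrightarrow> P w"
  shows "P y"
proof -
  have "(x, y) \<in> {(a, b). {a, b} \<in> edges H}\<^sup>*"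
    using assms unfolding connected_graph_def by blast
  then show ?thesis by (induction rule: rtrancl_induct) (use assms in auto)
qed

lemma bipartitionD:
  assumes "bipartition G A B"
  shows "verts G = A \<union> B" "A \<inter> B = {}"
    and "e \<in> edges G \<Longrightarrow> \<exists>p\<in>A. \<exists>q\<in>B. e = {p, q}"
  using assms by (simp_all add: bipartition_def)

lemma bipartition_swap:
  assumes "bipartition G A B"
  shows "bipartition G B A"
proof -
  have "\<exists>q\<in>B. \<exists>p\<in>A. e = {q, p}" if "e \<in> edges G" for e
    using bipartitionD(3)[OF assms that] by (metis insert_commute)
  then show ?thesis
    using bipartitionD(1,2)[OF assms] by (simp add: bipartition_def Un_commute Int_commute)
qed

text \<open>Some vertex of \<open>B\<close> lies on an edge. A path from \<open>p\<close> to it is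
  nontrivial because the sides are disjoint, and its first edge leaves \<open>p\<close>.\<close>

lemma bipartition_no_isolated:
  assumes "connected_graph H" "bipartition H A B" "edges H \<noteq> {}" "p \<in> A"
  shows "\<exists>q\<in>B. {p, q} \<in> edges H"
proof -
  note AB = bipartitionD[OF assms(2)]
  obtain e s where e: "e \<in> edges H" "s \<in> B" "s \<in> e"
    using assms(3) AB(3) by blast
  then have "(p, s) \<in> {(a, b). {a, b} \<in> edges H}\<^sup>*"
    using assms(1,4) AB(1) by (simp add: connected_graph_def)
  moreover have "p \<noteq> s" using assms(4) e(2) AB(2) by blast
  ultimately obtain q where q: "{p, q} \<in> edges H"
    by (cases rule: converse_rtranclE) simp_all
  then obtain p' q' where "p' \<in> A" "q' \<in> B" "{p, q} = {p', q'}"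
    using AB(3) by metis
  then have "q \<in> B" using assms(4) AB(2) by (auto simp: doubleton_eq_iff)
  then show ?thesis using q by blast
qed

text \<open>The witness is a matching, which contains no connected graph with two edges.\<close>

lemma half_le_ex_num:
  assumes "simple_graph H" "connected_graph H" "card (edges H) \<ge> 2"
  shows "n div 2 \<le> ex_num n H"
proof -
  let ?E = "(\<lambda>i. {2 * i, 2 * i + 1}) ` {..<n div 2}"
  let ?M = "\<lparr>verts = {..<n}, edges = ?E\<rparr>"
  have "simple_graph ?M"
    unfolding simple_graph_def
  proof (intro conjI ballI)
    fix e assume "e \<in> edges ?M"
    then obtain i where "i < n div 2" "e = {2 * i, 2 * i + 1}" by auto
    then show "\<exists>x\<in>verts ?M. \<exists>y\<in>verts ?M. x \<noteq> y \<and> e = {x, y}"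
      by (intro bexI[of _ "2 * i"] bexI[of _ "2 * i + 1"]) auto
  qed simp
  moreover have "\<not> contains_copy ?M H"
  proof
    assume "contains_copy ?M H"
    then obtain f where f: "inj_on f (verts H)" "\<And>e. e \<in> edges H \<Longrightarrow> f ` e \<in> ?E"
      using contains_copyD[of ?M H] by auto
    obtain x where x: "x \<in> verts H" using assms unfolding connected_graph_def by blast
    \<comment> \<open>\<open>f z div 2\<close> names the matching edge containing
      \<open>f z\<close>. It is constant along edges of \<open>H\<close>, so the whole copy lies in
      one matching edge.\<close>
    have step: "f w div 2 = f z div 2" if zw: "{z, w} \<in> edges H" for z w
    proof -
      obtain i where "f ` {z, w} = {2 * i, 2 * i + 1}" 
        using imageE[OF f(2)[OF zw]] by metis
      then show ?thesis by (auto simp: doubleton_eq_iff)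
    qed
    have "f y div 2 = f x div 2" if "y \<in> verts H" for y
      by (rule connected_graph_induct[OF assms(2) x that]) (use step in auto)
    moreover have "m \<in> {2 * (m div 2), 2 * (m div 2) + 1}" for m :: nat
      by simp linarith
    ultimately have "f ` verts H \<subseteq> {2 * (f x div 2), 2 * (f x div 2) + 1}"
      by (metis image_subsetI)
    then have "card (f ` verts H) \<le> card {2 * (f x div 2), 2 * (f x div 2) + 1}"
      by (intro card_mono) auto
    then have "card (f ` verts H) \<le> 2" by simp
    then have c: "card (verts H) \<le> 2" using f(1) by (simp add: card_image)
    have "edges H \<subseteq> {verts H}"
    proof
      fix e assume e: "e \<in> edges H"
      obtain y z where "y \<noteq> z" "e = {y, z}" "y \<in> verts H" "z \<in> verts H"
        using simple_graph_edgeE[OF assms(1) e] .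
      then have "card e = 2" by simp
      moreover have "e \<subseteq> verts H" "finite (verts H)"
        using e assms(1) simple_graph_edge_subset simple_graph_finite by blast+
      ultimately show "e \<in> {verts H}" using c card_seteq[of "verts H" e] by simp
    qed
    then have "card (edges H) \<le> 1" using card_mono[of "{verts H}"] by simp
    then show False using assms(3) by simp
  qed
  moreover have "card ?E = n div 2"
    by (subst card_image) (auto simp: inj_on_def doubleton_eq_iff)
  ultimately show ?thesis using card_edges_le_ex_num[of ?M n H] by simp
qed

section \<open>Gluing\<close>

text \<open>The renaming of \<open>v\<close> to \<open>u\<close> fixes all vertices of
  \<open>H1\<close>, so \<open>H1\<close> survives inside the glued graph. This gives the lower
  bound with constant 1.\<close>

lemma contains_copy_glue_imp:
  assumes "simple_graph G" "simple_graph H" "graph_iso \<phi> H H1"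
    and "verts H1 \<inter> verts H2 = {}" "v \<in> verts H2" "contains_copy G (glue H1 u H2 v)"
  shows "contains_copy G H"
proof -
  let ?q = "\<lambda>x. if x = v then u else x"
  obtain f where f: "inj_on f (verts (glue H1 u H2 v))" "f ` verts (glue H1 u H2 v) \<subseteq> verts G"
      "\<And>e. e \<in> edges (glue H1 u H2 v) \<Longrightarrow> f ` e \<in> edges G"
    using contains_copyD[OF assms(6)] by auto
  note \<phi> = graph_isoD[OF assms(3)]
  have q: "?q ` S = S" if "S \<subseteq> verts H1" for S using that assms(4,5) by auto
  have sub: "verts H1 \<subseteq> verts (glue H1 u H2 v)"
    using q[of "verts H1"] by (auto simp: glue_def Let_def image_Un)
  have ed: "\<phi> ` e \<in> edges (glue H1 u H2 v)" if e: "e \<in> edges H" for e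
  proof -
    have "\<phi> ` e \<subseteq> verts H1" using \<phi>(2) simple_graph_edge_subset[OF assms(2) e] by blast
    then have "\<phi> ` e = ?q ` (\<phi> ` e)" by (simp only: q)
    moreover have "\<phi> ` e \<in> edges H1" using \<phi> e by blast
    ultimately show ?thesis unfolding glue_def Let_def by (simp del: image_insert)
  qed
  show ?thesis
  proof (rule contains_copyI[where f = "f \<circ> \<phi>"])
    show "inj_on (f \<circ> \<phi>) (verts H)"
      using comp_inj_on[OF \<phi>(1)] inj_on_subset[OF f(1) sub] \<phi>(2) by simp
    show "(f \<circ> \<phi>) ` verts H \<subseteq> verts G"
      unfolding image_comp[symmetric] \<phi>(2) using image_mono[OF sub, of f] f(2) by (rule order_trans)
    show "(f \<circ> \<phi>) ` e \<in> edges G" if "e \<in> edges H" for e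
      using f(3)[OF ed[OF that]] unfolding image_comp[symmetric] .
  qed (use assms(1,2) simple_graph_edge_subset simple_graph_finite in blast)+
qed

text \<open>Use \<open>f\<close> on the vertices of \<open>H1\<close> and \<open>g\<close> on the
  others: \<open>f a = g b\<close> makes this consistent at the merged vertex, and the small
  intersection of the images makes it injective.\<close>

lemma contains_copy_glueI:
  fixes f g :: "'a \<Rightarrow> 'c"
  assumes "simple_graph G" "simple_graph H"
    and iso: "graph_iso \<phi>1 H H1" "graph_iso \<phi>2 H H2" and disj: "verts H1 \<inter> verts H2 = {}"
    and ab: "a \<in> verts H" "\<phi>1 a = u" "b \<in> verts H" "\<phi>2 b = v"
    and f: "inj_on f (verts H)" "f ` verts H \<subseteq> verts G" "\<And>e. e \<in> edges H \<Longrightarrow> f ` e \<in> edges G"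
    and g: "inj_on g (verts H)" "g ` verts H \<subseteq> verts G" "\<And>e. e \<in> edges H \<Longrightarrow> g ` e \<in> edges G"
    and fg: "f a = g b" "f ` verts H \<inter> g ` verts H \<subseteq> {f a}"
  shows "contains_copy G (glue H1 u H2 v)"
proof -
  define q where "q = (\<lambda>x. if x = v then u else x)"
  have V: "verts (glue H1 u H2 v) = q ` (verts H1 \<union> verts H2)"
    and E: "edges (glue H1 u H2 v) = (`) q ` (edges H1 \<union> edges H2)"
    by (auto simp: glue_def q_def Let_def)
  define \<psi>1 where "\<psi>1 = inv_into (verts H) \<phi>1"
  define \<psi>2 where "\<psi>2 = inv_into (verts H) \<phi>2"
  have \<phi>1: "inj_on \<phi>1 (verts H)" "\<phi>1 ` verts H = verts H1" "edges H1 = (`) \<phi>1 ` edges H"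
    and \<phi>2: "inj_on \<phi>2 (verts H)" "\<phi>2 ` verts H = verts H2" "edges H2 = (`) \<phi>2 ` edges H"
    using graph_isoD[OF iso(1)] graph_isoD[OF iso(2)] .
  have u: "u \<in> verts H1" "u \<notin> verts H2" and v: "v \<in> verts H2" "v \<notin> verts H1"
    using imageI[OF ab(1), of \<phi>1] imageI[OF ab(3), of \<phi>2] ab(2,4) \<phi>1(2) \<phi>2(2) disj by auto
  define h where "h z = (if z \<in> verts H1 then f (\<psi>1 z) else g (\<psi>2 z))" for z
  have h1: "h (q (\<phi>1 x)) = f x" if "x \<in> verts H" for x
  proof -
    have "\<phi>1 x \<in> verts H1" using imageI[OF that, of \<phi>1] \<phi>1(2) by simp
    moreover from this have "\<phi>1 x \<noteq> v" using v by auto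
    ultimately show ?thesis using that \<phi>1(1) by (simp add: h_def q_def \<psi>1_def)
  qed
  have h2: "h (q (\<phi>2 x)) = g x" if x: "x \<in> verts H" for x
  proof (cases "x = b")
    case True
    \<comment> \<open>The merged vertex keeps the name \<open>u\<close> from \<open>H1\<close>, so
      \<open>h\<close> evaluates \<open>f\<close> there.\<close>
    have "h (q (\<phi>2 x)) = f (\<psi>1 (\<phi>1 a))" using True ab u by (simp add: h_def q_def)
    also have "\<dots> = f a" unfolding \<psi>1_def inv_into_f_f[OF \<phi>1(1) ab(1)] ..
    finally show ?thesis using True fg by simp
  next
    case False
    then have "\<phi>2 x \<noteq> v" using ab x \<phi>2(1) by (auto dest: inj_onD)
    moreover have "\<phi>2 x \<in> verts H2" using imageI[OF x, of \<phi>2] \<phi>2(2) by simp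
    then have "\<phi>2 x \<notin> verts H1" using disj by blast
    ultimately show ?thesis using x \<phi>2(1) by (simp add: h_def q_def \<psi>2_def)
  qed
  have mix: "q (\<phi>1 x) = q (\<phi>2 y)" if x: "x \<in> verts H" and y: "y \<in> verts H" and eq: "f x = g y" for x y
  proof -
    have "f x \<in> f ` verts H \<inter> g ` verts H" 
      using imageI[OF x, of f] imageI[OF y, of g] eq by simp
    then have "f x = f a" using fg(2) by blast
    moreover from this have "g y = g b" using eq fg(1) by simp
    ultimately have "x = a" "y = b"
      using inj_onD[OF f(1) _ x ab(1)] inj_onD[OF g(1) _ y ab(3)] by simp_all
    then show ?thesis using ab u v by (auto simp: q_def)
  qed
  have Vim: "verts (glue H1 u H2 v) = (\<lambda>x. q (\<phi>1 x)) ` verts H \<union> (\<lambda>x. q (\<phi>2 x)) ` verts H"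
    unfolding V \<phi>1(2)[symmetric] \<phi>2(2)[symmetric] by (auto simp: image_Un image_image)
  show ?thesis
  proof (rule contains_copyI[where f = h])
    show "finite (verts (glue H1 u H2 v))"
      unfolding Vim using assms(2) by (auto simp: simple_graph_def)
    show "inj_on h (verts (glue H1 u H2 v))"
    proof (rule inj_onI)
      fix z w assume zw: "z \<in> verts (glue H1 u H2 v)" "w \<in> verts (glue H1 u H2 v)" "h z = h w"
      then consider x y where "x \<in> verts H" "y \<in> verts H" "z = q (\<phi>1 x)" "w = q (\<phi>1 y)"
        | x y where "x \<in> verts H" "y \<in> verts H" "z = q (\<phi>1 x)" "w = q (\<phi>2 y)"
        | x y where "x \<in> verts H" "y \<in> verts H" "z = q (\<phi>2 x)" "w = q (\<phi>1 y)"
        | x y where "x \<in> verts H" "y \<in> verts H" "z = q (\<phi>2 x)" "w = q (\<phi>2 y)"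
        unfolding Vim by blast
      then show "z = w"
      proof cases
        case 1 then show ?thesis using zw(3) h1 f(1) by (auto dest: inj_onD)
      next
        case 2 then show ?thesis using zw(3) h1 h2 mix by simp
      next
        case 3 then show ?thesis using zw(3) h1 h2 mix[of y x] by simp
      next
        case 4 then show ?thesis using zw(3) h2 g(1) by (auto dest: inj_onD)
      qed
    qed
    show "h ` verts (glue H1 u H2 v) \<subseteq> verts G"
      unfolding Vim using h1 h2 f(2) g(2) by (auto simp: image_subset_iff)
    fix e assume "e \<in> edges (glue H1 u H2 v)"
    then obtain e' where e': "e' \<in> edges H" "e = q ` \<phi>1 ` e' \<or> e = q ` \<phi>2 ` e'"
      unfolding E \<phi>1(3) \<phi>2(3) by blast
    have sub: "e' \<subseteq> verts H" using simple_graph_edge_subset[OF assms(2) e'(1)] .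
    show "e \<subseteq> verts (glue H1 u H2 v)" unfolding Vim using e'(2) sub by auto
    have "h ` e = f ` e' \<or> h ` e = g ` e'"
      using e'(2) sub h1 h2 by (auto simp: image_image subset_iff cong: image_cong_simp)
    then show "h ` e \<in> edges G" using f(3) g(3) e'(1) by auto
  qed fact
qed

section \<open>The upper bound\<close>

text \<open>The cut costs a factor 2 and each one-sided step a factor 16 plus at most
  \<open>n\<close>: 512 = 2 * 16 * 16 and 34 = 2 * (16 + 1).\<close>

lemma glue_free_edge_bound:
  fixes G :: "nat sgraph"
  assumes H: "simple_graph H" "connected_graph H" "bipartition H A B" "edges H \<noteq> {}"
    and iso: "graph_iso \<phi>1 H H1" "graph_iso \<phi>2 H H2" "verts H1 \<inter> verts H2 = {}"
    and ab: "a \<in> A" "\<phi>1 a = u" "b \<in> A" "\<phi>2 b = v"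
    and G: "simple_graph G" "card (verts G) = n" "\<not> contains_copy G (glue H1 u H2 v)"
  shows "card (edges G) \<le> 512 * ex_num n H + 34 * n"
proof -
  have VH: "verts H = A \<union> B" and AB: "A \<inter> B = {}"
    and EH: "\<And>e. e \<in> edges H \<Longrightarrow> \<exists>p\<in>A. \<exists>q\<in>B. e = {p, q}"
    using bipartitionD[OF H(3)] .
  have isoA: "\<And>p. p \<in> A \<Longrightarrow> \<exists>q\<in>B. {p, q} \<in> edges H"
    using bipartition_no_isolated[OF H(2,3,4)] .
  have isoB: "\<And>q. q \<in> B \<Longrightarrow> \<exists>p\<in>A. {p, q} \<in> edges H"
    using bipartition_no_isolated[OF H(2) bipartition_swap[OF H(3)] H(4)] by (metis insert_commute)
  have fin: "finite (verts G)" using G by (simp add: simple_graph_def)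
  define X where "X = (SOME S. S \<subseteq> verts G \<and>
    card (edges G) \<le> 2 * card {(x, y). {x, y} \<in> edges G \<and> x \<in> S \<and> y \<in> verts G - S})"
  define Y where "Y = verts G - X"
  define R where "R = {(x, y). {x, y} \<in> edges G \<and> x \<in> X \<and> y \<in> Y}"
  have "X \<subseteq> verts G \<and> card (edges G) \<le> 2 * card R"
    unfolding R_def Y_def X_def
    by (rule someI_ex, rule max_cut[OF fin]) (use G(1) in \<open>simp add: simple_graph_def\<close>)
  then have X: "X \<subseteq> verts G" and cR: "card (edges G) \<le> 2 * card R" by auto
  have XY: "finite X" "finite Y" "X \<inter> Y = {}" "R \<subseteq> X \<times> Y" "card X \<le> n" "card Y \<le> n"
    using X fin G(2) finite_subset[of X] by (auto simp: Y_def R_def card_mono)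
  \<comment> \<open>Any set of oriented edges of \<open>G\<close> is allowed, so that this serves
    both \<open>R\<close> and the converse of \<open>R1\<close>.\<close>
  have no_pair: False
    if R': "R' \<subseteq> {(x, y). {x, y} \<in> edges G}"
      and f: "bip_emb H A B R' f" and g: "bip_emb H A B R' g"
      and fg: "f a = g b" "f ` (A \<union> B) \<inter> g ` (A \<union> B) \<subseteq> {f a}" for R' f g
  proof -
    have emb: "inj_on k (verts H) \<and> k ` verts H \<subseteq> verts G \<and> (\<forall>e\<in>edges H. k ` e \<in> edges G)"
      if k: "bip_emb H A B R' k" for k
    proof -
      have ed: "\<forall>e\<in>edges H. k ` e \<in> edges G"
        using k R' EH unfolding bip_emb_def by fastforce
      have "k z \<in> verts G" if z: "z \<in> verts H" for z
      proof -
        obtain e where "e \<in> edges H" "z \<in> e" using z isoA isoB unfolding VH by blast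
        then have "k ` e \<in> edges G" "k z \<in> k ` e" using ed by simp_all
        then show ?thesis using simple_graph_edge_subset[OF G(1)] by (meson subsetD)
      qed
      then show ?thesis using k ed unfolding bip_emb_def VH by blast
    qed
    show False
      using G(3) contains_copy_glueI[OF G(1) H(1) iso, of a u b v f g] ab emb[OF f] emb[OF g] fg
      unfolding VH by blast
  qed
  obtain R1 where R1: "R1 \<subseteq> R" "\<And>f. \<not> bip_emb H A B R1 f" "card R \<le> 16 * card R1 + card X"
    using one_sided_free_subgraph[OF XY(1-4) isoA isoB ab(1,3)] no_pair[of R]
    unfolding R_def by blast
  \<comment> \<open>With the sides exchanged, this destroys the copies that place \<open>A\<close>
    in \<open>Y\<close>; passing to fewer pairs creates no copy with \<open>A\<close> in
    \<open>X\<close>.\<close>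
  have "\<exists>R'\<subseteq>R1\<inverse>. (\<forall>f. \<not> bip_emb H A B R' f) \<and> card (R1\<inverse>) \<le> 16 * card R' + card Y"
  proof (rule one_sided_free_subgraph[OF XY(2,1) _ _ isoA isoB ab(1,3)])
    have "R1\<inverse> \<subseteq> {(x, y). {x, y} \<in> edges G}" using R1(1) by (auto simp: R_def insert_commute)
    then show "False" if "bip_emb H A B (R1\<inverse>) f" "bip_emb H A B (R1\<inverse>) g" "f a = g b"
      "f ` (A \<union> B) \<inter> g ` (A \<union> B) \<subseteq> {f a}" for f g
      using no_pair that by blast
  qed (use XY R1 in auto)
  then obtain R2 where R2: "R2 \<subseteq> R1\<inverse>" "\<And>f. \<not> bip_emb H A B R2 f"
      "card R1 \<le> 16 * card R2 + card Y"
    by auto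
  have R2sub: "R2 \<subseteq> Y \<times> X" using R2(1) R1(1) XY(4) by blast
  let ?E = "(\<lambda>(x, y). {x, y}) ` R2"
  let ?G2 = "\<lparr>verts = verts G, edges = ?E\<rparr>"
  have inE: "{z, w} \<in> ?E \<longleftrightarrow> (z, w) \<in> R2 \<or> (w, z) \<in> R2" for z w
    by (auto simp: image_iff doubleton_eq_iff Bex_def)
  have "simple_graph ?G2"
    unfolding simple_graph_def
  proof (intro conjI ballI)
    fix e assume "e \<in> edges ?G2"
    then obtain x y where "(x, y) \<in> R2" "e = {x, y}" by auto
    then have "x \<in> verts G" "y \<in> verts G" "x \<noteq> y \<and> e = {x, y}"
      using R2sub X XY(3) by (auto simp: Y_def)
    then show "\<exists>x\<in>verts ?G2. \<exists>y\<in>verts ?G2. x \<noteq> y \<and> e = {x, y}"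
      unfolding sgraph.simps by (intro bexI)
  qed (simp add: fin)
  moreover have "\<not> contains_copy ?G2 H"
  proof
    assume "contains_copy ?G2 H"
    then obtain f where "inj_on f (verts H) \<and> f ` verts H \<subseteq> verts ?G2 \<and> (\<forall>e\<in>edges H. f ` e \<in> edges ?G2)"
      using contains_copyD[of ?G2 H] by metis
    then have f: "inj_on f (verts H)" "\<And>e. e \<in> edges H \<Longrightarrow> f ` e \<in> ?E"
      by simp_all
    have step: "(z, w) \<in> {(z, w). {z, w} \<in> edges H} \<Longrightarrow> (f z, f w) \<in> R2 \<or> (f w, f z) \<in> R2" for z w
      using f(2)[of "{z, w}"] inE by simp
    have a: "a \<in> verts H" using ab VH by simp
    \<comment> \<open>Every edge switches sides both in \<open>H\<close> and in the cut, so by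
      connectedness a copy places \<open>A\<close> entirely in \<open>X\<close> or entirely in
      \<open>Y\<close>.\<close>
    have parity: "(z \<in> A \<longleftrightarrow> f z \<in> X) \<longleftrightarrow> (a \<in> A \<longleftrightarrow> f a \<in> X)" if "z \<in> verts H" for z
    proof (rule connected_graph_induct[OF H(2) a that])
      fix z w assume zw: "{z, w} \<in> edges H" and IH: "(z \<in> A \<longleftrightarrow> f z \<in> X) \<longleftrightarrow> (a \<in> A \<longleftrightarrow> f a \<in> X)"
      have "w \<in> A \<longleftrightarrow> z \<notin> A" using EH[OF zw] AB by (auto simp: doubleton_eq_iff)
      moreover have "f w \<in> X \<longleftrightarrow> f z \<notin> X" using step[of z w] zw R2sub XY(3) by auto
      ultimately show "(w \<in> A \<longleftrightarrow> f w \<in> X) \<longleftrightarrow> (a \<in> A \<longleftrightarrow> f a \<in> X)" using IH by blast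
    qed simp
    show False
    proof (cases "f a \<in> X")
      case True
      have "bip_emb H A B (R2\<inverse>) f"
        unfolding bip_emb_def
      proof (intro conjI ballI impI)
        fix p q assume "p \<in> A" "q \<in> B" "{p, q} \<in> edges H"
        moreover from this have "f p \<in> X" using parity[of p] True ab(1) VH by blast
        ultimately show "(f p, f q) \<in> R2\<inverse>" using step[of p q] R2sub XY(3) by auto
      qed (use f VH in simp)
      then show False using R1(2)[of f] R2(1) bip_emb_mono[of H A B "R2\<inverse>" f R1] by blast
    next
      case False
      have "bip_emb H A B R2 f"
        unfolding bip_emb_def
      proof (intro conjI ballI impI)
        fix p q assume "p \<in> A" "q \<in> B" "{p, q} \<in> edges H"
        moreover from this have "f p \<notin> X" using parity[of p] False ab(1) VH by blast
        ultimately show "(f p, f q) \<in> R2" using step[of p q] R2sub XY(3) by auto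
      qed (use f VH in simp)
      then show False using R2(2) by blast
    qed
  qed
  moreover have "inj_on (\<lambda>(x, y). {x, y}) (Y \<times> X)"
    using XY(3) by (auto simp: inj_on_def doubleton_eq_iff)
  then have "card ?E = card R2" using R2sub by (intro card_image) (rule inj_on_subset)
  ultimately have "card R2 \<le> ex_num n H" using card_edges_le_ex_num[of ?G2 n H] G(2) by simp
  then show ?thesis using cR R1(3) R2(3) XY(5,6) by linarith
qed

text \<open>For \<open>n \<ge> 2\<close>, \<open>n \<le> 3 * (n div 2)\<close>, so the matching
  bound absorbs the linear term: 614 = 512 + 3 * 34.\<close>

lemma ex_num_glue_bound:
  assumes H: "simple_graph H" "connected_graph H" "bipartition H A B" "card (edges H) \<ge> 2"
    and iso: "graph_iso \<phi>1 H H1" "graph_iso \<phi>2 H H2" "verts H1 \<inter> verts H2 = {}"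
    and ab: "a \<in> A" "\<phi>1 a = u" "b \<in> A" "\<phi>2 b = v" and n: "n \<ge> 2"
  shows "ex_num n (glue H1 u H2 v) \<le> 614 * ex_num n H"
proof -
  have "edges H \<noteq> {}" using H(4) by auto
  then have "ex_num n (glue H1 u H2 v) \<le> 512 * ex_num n H + 34 * n"
    using glue_free_edge_bound[OF H(1-3) _ iso ab] by (intro ex_num_le)
  moreover have "n \<le> 3 * ex_num n H"
    using half_le_ex_num[OF H(1,2,4), of n] n by linarith
  ultimately show ?thesis by linarith
qed

text \<open>Every nonempty graph contains a single vertex, so no graph competes and the default
  value 0 remains.\<close>

lemma ex_num_singleton:
  assumes "verts F = {x}" "edges F = {}" "n \<ge> 1"
  shows "ex_num n F = 0"
proof -
  have "contains_copy G F" if G: "simple_graph G" "card (verts G) = n" for G :: "nat sgraph"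
  proof -
    obtain y where "y \<in> verts G" using G assms(3) by fastforce
    then show ?thesis using G assms by (intro contains_copyI[where f = "\<lambda>_. y"]) auto
  qed
  then have "ex_num n F \<le> 0" by (intro ex_num_le) blast
  then show ?thesis by simp
qed

(* The single edge K_2 must be excluded: ex(n, K_2) = 0, whereas gluing two copies of K_2
   gives the path with two edges, whose extremal number is floor(n/2). *)
theorem theorem2:
  fixes H :: "'a sgraph" and A B :: "'a set"
    and H1 H2 :: "'b sgraph" and \<phi>1 \<phi>2 :: "'a \<Rightarrow> 'b"
    and a b :: 'a and u v :: 'b
  assumes "simple_graph H" and "connected_graph H" and "bipartition H A B"
    and not_K2: "card (edges H) \<noteq> 1"
    and "graph_iso \<phi>1 H H1" and "graph_iso \<phi>2 H H2" and "verts H1 \<inter> verts H2 = {}"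
    and "u \<in> verts H1" and "v \<in> verts H2"
    and "a \<in> verts H" and "\<phi>1 a = u" and "b \<in> verts H" and "\<phi>2 b = v"
    and "(a \<in> A \<and> b \<in> A) \<or> (a \<in> B \<and> b \<in> B)"
  shows "(\<lambda>n. real (ex_num n (glue H1 u H2 v))) \<in> \<Theta>(\<lambda>n. real (ex_num n H))"
proof (cases "edges H = {}")
  case True
  \<comment> \<open>Without edges a connected graph is one vertex, and gluing two such graphs again
    gives one vertex.\<close>
  have "verts H = {a}"
  proof -
    have "y = a" if "y \<in> verts H" for y
      by (rule connected_graph_induct[OF assms(2) \<open>a \<in> verts H\<close> that]) (use True in auto)
    then show ?thesis using \<open>a \<in> verts H\<close> by blast
  qed
  moreover from this have "verts H1 = {u}" "verts H2 = {v}" "edges H1 = {}" "edges H2 = {}"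
    using assms True by (auto simp: graph_iso_def bij_betw_def)
  ultimately have "ex_num n (glue H1 u H2 v) = ex_num n H" if "n \<ge> 1" for n
    using that True
    by (subst ex_num_singleton[of H a], simp_all, intro ex_num_singleton[of _ u])
      (auto simp: glue_def Let_def)
  then have "eventually (\<lambda>n. real (ex_num n (glue H1 u H2 v)) = real (ex_num n H)) at_top"
    by (intro eventually_sequentiallyI[of 1]) simp
  then show ?thesis by (rule bigthetaI_cong)
next
  case False
  have "finite (edges H)"
    by (rule finite_subset[of _ "Pow (verts H)"])
      (use assms(1) simple_graph_edge_subset simple_graph_finite in auto)
  then have c: "card (edges H) \<ge> 2"
    using False not_K2 by (metis One_nat_def Suc_1 Suc_leI card_gt_0_iff le_neq_implies_less)
  \<comment> \<open>The bound is stated for \<open>A\<close>; exchanging the two classes covers the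
    case where \<open>a\<close> and \<open>b\<close> lie in \<open>B\<close>.\<close>
  have upper: "ex_num n (glue H1 u H2 v) \<le> 614 * ex_num n H" if "n \<ge> 2" for n
    using assms(14)
      ex_num_glue_bound[OF assms(1,2,3) c assms(5-7) _ assms(11) _ assms(13) that]
      ex_num_glue_bound[OF assms(1,2) bipartition_swap[OF assms(3)] c assms(5-7) _ assms(11) _ assms(13) that]
    by auto
  have lower: "ex_num n H \<le> ex_num n (glue H1 u H2 v)" for n
    using contains_copy_glue_imp[OF _ assms(1,5,7,9)]
    by (intro ex_num_le card_edges_le_ex_num) auto
  show ?thesis
  proof (rule bigthetaI)
    show "(\<lambda>n. real (ex_num n (glue H1 u H2 v))) \<in> O(\<lambda>n. real (ex_num n H))"
    proof (rule bigoI[where c = 614])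
      show "\<forall>\<^sub>F n in at_top. norm (real (ex_num n (glue H1 u H2 v))) \<le> 614 * norm (real (ex_num n H))"
        using eventually_ge_at_top[of 2]
      proof eventually_elim
        case (elim n)
        then show ?case using upper[of n] by simp
      qed
    qed
    show "(\<lambda>n. real (ex_num n (glue H1 u H2 v))) \<in> \<Omega>(\<lambda>n. real (ex_num n H))"
      unfolding bigomega_iff_bigo by (rule bigoI[where c = 1]) (simp add: lower)
  qed
qed

end
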